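(* Let $\beta>2$. There exists a polynomial time algorithm which approximates the Minimum Vertex Cover problem on random power law graphs drawn from the $(\alpha,\beta)$-model $M(\alpha,\beta)$ (graphs being given instance by instance) with expected approximation ratio \[\rho = 2-\frac{\zeta(\beta)-1-\frac{1}{2^{\beta}}}{2^{\beta}\,\zeta(\beta-1)\,\zeta(\beta)},\] where $\zeta$ is the Riemann zeta function.
   Context: Minimum Vertex Cover: given an undirected (multi)graph $G=(V,E)$, find a set $C\subseteq V$ of minimum cardinality such that every edge has at least one endpoint in $C$. The $(\alpha,\beta)$-model $M(\alpha,\beta)$ (Aiello–Chung–Lu): for real parameters $\alpha>0$, $\beta>0$, let $\Delta=\lfloor e^{\alpha/\beta}\rfloor$; for each $1\le i\le\Delta$ there are $y_i$ vertices of degree $i$, where $y_i=\lfloor e^{\alpha}/i^{\beta}\rfloor$ if $i>1$ or if $\sum_{i=1}^{\Delta}\lfloor e^{\alpha}/i^{\beta}\rfloor$ is even, and $y_1=\lfloor e^{\alpha}\rfloor+1$ otherwise. A random multigraph (self-loops and multi-edges allowed) with this degree sequence is generated by creating $\deg(v)$ distinct copies of each vertex $v$, choosing a uniformly random perfect matching on the set of all copies, and letting the number of edges between $u$ and $v$ equal the number of matching pairs joining a copy of $u$ with a copy of $v$. Following the paper, the quantities $e^{\alpha}/i^{\beta}$ and $e^{\alpha/\beta}$ are used in place of their integer parts (for $\beta>2$ the error is of lower order). The expected approximation ratio refers to expectation over $G\sim M(\alpha,\beta)$ of the ratio between the size of the computed cover and the optimum.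
   Formalization: The extra degree-1 vertex is added when the sum of the degrees (not the number of vertices) is odd; the printed rule can give an odd degree sum, for which no perfect matching exists, and both rules agree whenever the printed one gives an even degree sum. *)

theory Defs
  imports
    "HOL-Probability.Probability"
    "HOL-Computational_Algebra.Polynomial"
    "HOL-Library.Multiset"
    "HOL-Library.Disjoint_Sets"
begin

section \<open>Multigraphs and vertex covers\<close>

text \<open>
  A pair \<open>(n, E)\<close> stands for the undirected multigraph with vertex set \<open>{..<n}\<close> and
  edge multiset \<open>E\<close>; an edge is the set of its endpoints, so a self-loop at \<open>v\<close> is the
  singleton \<open>{v}\<close>.
\<close>

type_synonym mgraph = "nat \<times> nat set multiset"

definition verts :: "mgraph \<Rightarrow> nat set" where
  "verts G = {..<fst G}"

definition edges :: "mgraph \<Rightarrow> nat set multiset" where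
  "edges G = snd G"

definition multigraph :: "mgraph \<Rightarrow> bool" where
  "multigraph G \<longleftrightarrow> (\<forall>e \<in># edges G. e \<subseteq> verts G \<and> (card e = 1 \<or> card e = 2))"

definition vertex_cover :: "mgraph \<Rightarrow> nat set \<Rightarrow> bool" where
  "vertex_cover G C \<longleftrightarrow> C \<subseteq> verts G \<and> (\<forall>e \<in># edges G. e \<inter> C \<noteq> {})"

definition vc_opt :: "mgraph \<Rightarrow> nat" where
  "vc_opt G = Min (card ` {C. vertex_cover G C})"

definition approx_ratio :: "(mgraph \<Rightarrow> nat set) \<Rightarrow> mgraph \<Rightarrow> real" where
  "approx_ratio f G = real (card (f G)) / real (vc_opt G)"


section \<open>Polynomial-time computation on a random access machine\<close>

text \<open>
  The machine has registers and a heap, both indexed by and holding natural numbers, and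
  every instruction and every test costs one time unit. The arithmetic instructions are
  addition and truncated subtraction only, so each step increases the maximal bit length of
  the stored numbers by at most a constant. Hence polynomially many unit-cost steps can be
  simulated by a Turing machine in polynomial time, and conversely.
\<close>

type_synonym ram_state = "(nat \<Rightarrow> nat) \<times> (nat \<Rightarrow> nat)"

datatype prog =
    Skip
  | Const nat nat
  | Add nat nat nat
  | Sub nat nat nat
  | Load nat nat
  | Store nat nat
  | Seq prog prog
  | Cond nat prog prog
  | While nat prog

text \<open>\<open>exec c s t s'\<close>: started in \<open>s\<close>, \<open>c\<close> halts after exactly \<open>t\<close> steps in \<open>s'\<close>.\<close>

inductive exec :: "prog \<Rightarrow> ram_state \<Rightarrow> nat \<Rightarrow> ram_state \<Rightarrow> bool" where
  Skip: "exec Skip s 1 s"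
| Const: "exec (Const i k) (R, H) 1 (R(i := k), H)"
| Add: "exec (Add i j k) (R, H) 1 (R(i := R j + R k), H)"
| Sub: "exec (Sub i j k) (R, H) 1 (R(i := R j - R k), H)"
| Load: "exec (Load i j) (R, H) 1 (R(i := H (R j)), H)"
| Store: "exec (Store i j) (R, H) 1 (R, H(R i := R j))"
| Seq: "exec c s t s' \<Longrightarrow> exec d s' u s'' \<Longrightarrow> exec (Seq c d) s (t + u) s''"
| CondT: "fst s i \<noteq> 0 \<Longrightarrow> exec c s t s' \<Longrightarrow> exec (Cond i c d) s (t + 1) s'"
| CondF: "fst s i = 0 \<Longrightarrow> exec d s t s' \<Longrightarrow> exec (Cond i c d) s (t + 1) s'"
| WhileF: "fst s i = 0 \<Longrightarrow> exec (While i c) s 1 s"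
| WhileT: "fst s i \<noteq> 0 \<Longrightarrow> exec c s t s' \<Longrightarrow> exec (While i c) s' u s'' \<Longrightarrow>
    exec (While i c) s (t + u + 1) s''"

text \<open>
  A graph on \<open>n\<close> vertices is presented by \<open>n\<close> in register 0 and its adjacency matrix of edge
  multiplicities, row by row, in heap cells \<open>0, \<dots>, n * n - 1\<close>; everything else is 0.
  The computed vertex set is read off as a 0/non-0 vector from the \<open>n\<close> heap cells that
  follow the matrix.
\<close>

definition ram_input :: "mgraph \<Rightarrow> ram_state" where
  "ram_input G = (let n = fst G in
     ((\<lambda>i. if i = 0 then n else 0),
      (\<lambda>a. if a < n * n then count (edges G) {a div n, a mod n} else 0)))"

definition ram_output :: "mgraph \<Rightarrow> ram_state \<Rightarrow> nat set" where
  "ram_output G s = (let n = fst G in {v. v < n \<and> snd s (n * n + v) \<noteq> 0})"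

definition poly_time_computable :: "(mgraph \<Rightarrow> nat set) \<Rightarrow> bool" where
  "poly_time_computable f \<longleftrightarrow>
     (\<exists>(c :: prog) (p :: nat poly). \<forall>G. multigraph G \<longrightarrow>
        (\<exists>t s. exec c (ram_input G) t s \<and>
               t \<le> poly p (card (verts G) + size (edges G)) \<and>
               ram_output G s = f G))"


section \<open>The random multigraph with a given degree sequence\<close>

definition copies :: "nat list \<Rightarrow> (nat \<times> nat) set" where
  "copies ds = (SIGMA v : {..<length ds}. {..<ds ! v})"

definition perfect_matchings :: "'a set \<Rightarrow> 'a set set set" where
  "perfect_matchings S = {M. partition_on S M \<and> (\<forall>p \<in> M. card p = 2)}"

text \<open>Each matching pair is sent to the set of vertices whose copies it joins.\<close>

definition matching_graph :: "nat list \<Rightarrow> (nat \<times> nat) set set \<Rightarrow> mgraph" where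
  "matching_graph ds M = (length ds, image_mset (\<lambda>p. fst ` p) (mset_set M))"

definition random_multigraph :: "nat list \<Rightarrow> mgraph pmf" where
  "random_multigraph ds =
     map_pmf (matching_graph ds) (pmf_of_set (perfect_matchings (copies ds)))"

lemma finite_perfect_matchings: "finite S \<Longrightarrow> finite (perfect_matchings S)"
  by (rule finite_subset[of _ "Pow (Pow S)"])
     (auto simp: perfect_matchings_def partition_on_def)

lemma perfect_matchings_nonempty:
  assumes "finite S" "even (card S)"
  shows "perfect_matchings S \<noteq> {}"
  using assms
proof (induction "card S" arbitrary: S rule: less_induct)
  case less
  show ?case
  proof (cases "S = {}")
    case True
    then have "{} \<in> perfect_matchings S"
      by (simp add: perfect_matchings_def partition_on_def)
    then show ?thesis by blast
  next
    case False
    with less.prems have "card S \<noteq> 0" "card S \<noteq> 1" by auto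
    then have "2 \<le> card S" by linarith
    then obtain p where p: "p \<subseteq> S" "card p = 2"
      by (meson obtain_subset_with_card_n)
    then have fp: "finite p" using less.prems finite_subset by blast
    then have c: "card (S - p) = card S - 2" using p card_Diff_subset by metis
    then obtain M where M: "M \<in> perfect_matchings (S - p)"
      using less.hyps[of "S - p"] less.prems \<open>2 \<le> card S\<close> by fastforce
    have "insert p M \<in> perfect_matchings S"
      using M p by (auto simp: perfect_matchings_def partition_on_def disjoint_def)
    then show ?thesis by blast
  qed
qed


section \<open>The power law model\<close>

definition max_degree :: "real \<Rightarrow> real \<Rightarrow> nat" where
  "max_degree \<alpha> \<beta> = nat \<lfloor>exp (\<alpha> / \<beta>)\<rfloor>"

definition base_count :: "real \<Rightarrow> real \<Rightarrow> nat \<Rightarrow> nat" where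
  "base_count \<alpha> \<beta> i =
     (if 1 \<le> i \<and> i \<le> max_degree \<alpha> \<beta> then nat \<lfloor>exp \<alpha> / real i powr \<beta>\<rfloor> else 0)"

text \<open>
  The extra vertex of degree 1 serves to make the degree sum even, without which there is no
  perfect matching on the copies. In the literature the parity condition is often printed
  with the number of vertices \<open>\<Sum>i. base_count \<alpha> \<beta> i\<close> in place of the degree sum. The lemma
  \<open>deg_count_eq_vertex_parity\<close> below shows that the two versions agree whenever the printed
  one has an even degree sum, that is, whenever it defines a random graph at all.
\<close>

definition deg_count :: "real \<Rightarrow> real \<Rightarrow> nat \<Rightarrow> nat" where
  "deg_count \<alpha> \<beta> i =
     (if i > 1 \<or> even (\<Sum>j = 1..max_degree \<alpha> \<beta>. j * base_count \<alpha> \<beta> j)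
      then base_count \<alpha> \<beta> i
      else if i = 1 then nat \<lfloor>exp \<alpha>\<rfloor> + 1 else 0)"

definition deg_count_vertex_parity :: "real \<Rightarrow> real \<Rightarrow> nat \<Rightarrow> nat" where
  "deg_count_vertex_parity \<alpha> \<beta> i =
     (if i > 1 \<or> even (\<Sum>j = 1..max_degree \<alpha> \<beta>. base_count \<alpha> \<beta> j)
      then base_count \<alpha> \<beta> i
      else if i = 1 then nat \<lfloor>exp \<alpha>\<rfloor> + 1 else 0)"

text \<open>
  The vertices are labelled \<open>0, \<dots>, length ds - 1\<close> and \<open>ds ! v\<close> is the degree of \<open>v\<close>;
  the order in which the degrees are assigned to the labels is arbitrary.
\<close>

definition power_law_degrees :: "real \<Rightarrow> real \<Rightarrow> nat list \<Rightarrow> bool" where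
  "power_law_degrees \<alpha> \<beta> ds \<longleftrightarrow> (\<forall>i. count (mset ds) i = deg_count \<alpha> \<beta> i)"

lemma max_degree_ge_1: "\<alpha> > 0 \<Longrightarrow> \<beta> > 0 \<Longrightarrow> 1 \<le> max_degree \<alpha> \<beta>"
proof -
  assume "\<alpha> > 0" "\<beta> > 0"
  then have "1 \<le> exp (\<alpha> / \<beta>)" by simp
  then have "1 \<le> \<lfloor>exp (\<alpha> / \<beta>)\<rfloor>" by linarith
  then show ?thesis unfolding max_degree_def by linarith
qed

lemma base_count_1: "\<alpha> > 0 \<Longrightarrow> \<beta> > 0 \<Longrightarrow> base_count \<alpha> \<beta> 1 = nat \<lfloor>exp \<alpha>\<rfloor>"
  using max_degree_ge_1 by (simp add: base_count_def)

lemma split_off_degree_1: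
  fixes f :: "nat \<Rightarrow> nat"
  assumes "\<alpha> > 0" "\<beta> > 0"
  shows "(\<Sum>i = 1..max_degree \<alpha> \<beta>. f i) = f 1 + (\<Sum>i = 2..max_degree \<alpha> \<beta>. f i)"
  using max_degree_ge_1[OF assms] by (simp add: sum.atLeast_Suc_atMost numeral_2_eq_2)

lemma even_deg_sum:
  assumes "\<alpha> > 0" "\<beta> > 0"
  shows "even (\<Sum>i = 1..max_degree \<alpha> \<beta>. i * deg_count \<alpha> \<beta> i)"
proof -
  have "(\<Sum>i = 2..max_degree \<alpha> \<beta>. i * deg_count \<alpha> \<beta> i) =
        (\<Sum>i = 2..max_degree \<alpha> \<beta>. i * base_count \<alpha> \<beta> i)"
    by (intro sum.cong) (auto simp: deg_count_def)
  then show ?thesis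
    using split_off_degree_1[OF assms, of "\<lambda>i. i * deg_count \<alpha> \<beta> i"]
      split_off_degree_1[OF assms, of "\<lambda>i. i * base_count \<alpha> \<beta> i"] base_count_1[OF assms]
    by (auto simp: deg_count_def)
qed

lemma deg_count_eq_vertex_parity:
  assumes "\<alpha> > 0" "\<beta> > 0"
    and "even (\<Sum>i = 1..max_degree \<alpha> \<beta>. i * deg_count_vertex_parity \<alpha> \<beta> i)"
  shows "deg_count_vertex_parity \<alpha> \<beta> = deg_count \<alpha> \<beta>"
proof
  fix i
  have "(\<Sum>i = 2..max_degree \<alpha> \<beta>. i * deg_count_vertex_parity \<alpha> \<beta> i) =
        (\<Sum>i = 2..max_degree \<alpha> \<beta>. i * base_count \<alpha> \<beta> i)"
    by (intro sum.cong) (auto simp: deg_count_vertex_parity_def)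
  then have "deg_count_vertex_parity \<alpha> \<beta> 1 = deg_count \<alpha> \<beta> 1"
    using assms(3) split_off_degree_1[OF assms(1,2), of "\<lambda>i. i * deg_count_vertex_parity \<alpha> \<beta> i"]
      split_off_degree_1[OF assms(1,2), of "\<lambda>i. i * base_count \<alpha> \<beta> i"]
      base_count_1[OF assms(1,2)]
    by (auto simp: deg_count_def deg_count_vertex_parity_def split: if_splits)
  then show "deg_count_vertex_parity \<alpha> \<beta> i = deg_count \<alpha> \<beta> i"
    by (cases "i > 1"; cases "i = 0")
       (auto simp: deg_count_def deg_count_vertex_parity_def base_count_def le_Suc_eq not_less)
qed

definition zeta :: "real \<Rightarrow> real" where
  "zeta s = (\<Sum>n. 1 / real (Suc n) powr s)"

end

theory Submission
  imports Defs "HOL-Combinatorics.Transposition" "HOL-Real_Asymp.Real_Asymp"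
begin

text \<open>
  The algorithm is the greedy maximal matching heuristic, which selects both endpoints of every
  matching edge, except that a single endpoint is selected for an edge that forms a whole
  component. The matching edges are disjoint and contain every isolated edge, so the cover has at
  most \<open>2 opt - k\<close> vertices, where \<open>k\<close> is the number of isolated edges, and its ratio is at most
  \<open>2 - k / n\<close>. Two given copies are matched with probability \<open>1 / (D - 1)\<close>, where \<open>D\<close> is the sum
  of the degrees; hence \<open>m\<close> vertices of degree 1 yield at least \<open>(m choose 2) / (D - 1)\<close> isolated
  edges on average. For \<open>\<beta> > 2\<close> this number is at least \<open>n / (10 \<zeta>(\<beta> - 1) \<zeta>(\<beta>))\<close>
  for every \<open>\<alpha> > 0\<close>, integer parts and parity correction included, and the claimed gain over 2
  is at most \<open>1 / (10 \<zeta>(\<beta> - 1) \<zeta>(\<beta>))\<close>, because \<open>2\<^sup>\<beta> > 4\<close> and \<open>\<zeta>(\<beta>) - 1 - 2\<^sup>-\<^sup>\<beta> \<le> 2 / 5\<close>.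
\<close>

section \<open>Running programs\<close>

primrec loopfree :: "prog \<Rightarrow> bool" where
  "loopfree Skip = True"
| "loopfree (Const i k) = True"
| "loopfree (Add i j k) = True"
| "loopfree (Sub i j k) = True"
| "loopfree (Load i j) = True"
| "loopfree (Store i j) = True"
| "loopfree (Seq c d) = (loopfree c \<and> loopfree d)"
| "loopfree (Cond i c d) = (loopfree c \<and> loopfree d)"
| "loopfree (While i c) = False"

text \<open>A functional semantics, so that straight-line code can be verified by simplification.
  The value at \<open>While\<close> is a dummy: \<open>sem\<close> is related to \<open>exec\<close>
  for loop-free programs only.\<close>

primrec sem :: "prog \<Rightarrow> ram_state \<Rightarrow> ram_state" where
  "sem Skip s = s"
| "sem (Const i k) s = ((fst s)(i := k), snd s)"
| "sem (Add i j k) s = ((fst s)(i := fst s j + fst s k), snd s)"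
| "sem (Sub i j k) s = ((fst s)(i := fst s j - fst s k), snd s)"
| "sem (Load i j) s = ((fst s)(i := snd s (fst s j)), snd s)"
| "sem (Store i j) s = (fst s, (snd s)(fst s i := fst s j))"
| "sem (Seq c d) s = sem d (sem c s)"
| "sem (Cond i c d) s = (if fst s i \<noteq> 0 then sem c s else sem d s)"
| "sem (While i c) s = s"

text \<open>An upper bound rather than the exact running time: a conditional is charged for both
  branches.\<close>

primrec cost :: "prog \<Rightarrow> nat" where
  "cost Skip = 1"
| "cost (Const i k) = 1"
| "cost (Add i j k) = 1"
| "cost (Sub i j k) = 1"
| "cost (Load i j) = 1"
| "cost (Store i j) = 1"
| "cost (Seq c d) = cost c + cost d"
| "cost (Cond i c d) = cost c + cost d + 1"
| "cost (While i c) = 0"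

lemma exec_loopfree: "loopfree c \<Longrightarrow> \<exists>t \<le> cost c. exec c s t (sem c s)"
proof (induction c arbitrary: s)
  case (Seq c d)
  then obtain t u where "t \<le> cost c" "exec c s t (sem c s)"
    "u \<le> cost d" "exec d (sem c s) u (sem d (sem c s))" by (metis loopfree.simps(7))
  then show ?case by (auto intro!: exI[of _ "t + u"] exec.Seq)
next
  case (Cond i c d)
  then obtain t u where "t \<le> cost c" "exec c s t (sem c s)" "u \<le> cost d" "exec d s u (sem d s)"
    by (metis loopfree.simps(8))
  then have "fst s i \<noteq> 0 \<Longrightarrow> exec (Cond i c d) s (t + 1) (sem c s)" "t + 1 \<le> cost (Cond i c d)"
    "fst s i = 0 \<Longrightarrow> exec (Cond i c d) s (u + 1) (sem d s)" "u + 1 \<le> cost (Cond i c d)"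
    using exec.CondT exec.CondF by simp_all
  then show ?case by (metis sem.simps(8))
qed (cases s; auto intro: exec.intros exec.intros[simplified])+

section \<open>Reachability within a time bound\<close>

definition reaches :: "prog \<Rightarrow> ram_state \<Rightarrow> nat \<Rightarrow> (ram_state \<Rightarrow> bool) \<Rightarrow> bool" where
  "reaches c s T Q \<longleftrightarrow> (\<exists>t s'. exec c s t s' \<and> t \<le> T \<and> Q s')"

lemma reaches_loopfree:
  "loopfree c \<Longrightarrow> cost c \<le> T \<Longrightarrow> Q (sem c s) \<Longrightarrow> reaches c s T Q"
  unfolding reaches_def using exec_loopfree le_trans by blast

lemma reaches_Seq:
  assumes "reaches c s T P" "\<And>s'. P s' \<Longrightarrow> reaches d s' U Q"
  shows "reaches (Seq c d) s (T + U) Q"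
  using assms unfolding reaches_def by (meson add_mono exec.Seq)

text \<open>Register \<open>i\<close> counts down the remaining rounds, which makes it both loop
  test and induction measure. A round costs at most \<open>T\<close> plus one test, and the final
  failing test adds 1.\<close>

lemma reaches_While:
  assumes "I k s" "k \<le> n"
    and "\<And>k s. I k s \<Longrightarrow> fst s i = n - k"
    and "\<And>k s. I k s \<Longrightarrow> k < n \<Longrightarrow> reaches c s T (I (Suc k))"
  shows "reaches (While i c) s ((T + 1) * (n - k) + 1) (I n)"
  using assms(1,2)
proof (induction "n - k" arbitrary: k s)
  case 0
  then have "fst s i = 0" "I n s" using assms(3)[of k s] by auto
  then show ?case unfolding reaches_def using exec.WhileF[of s i c] by (metis le_add2)
next
  case (Suc m)
  then have k: "k < n" by simp
  obtain t s' where s': "exec c s t s'" "t \<le> T" "I (Suc k) s'"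
    using assms(4)[OF Suc.prems(1) k] unfolding reaches_def by blast
  obtain u s'' where s'': "exec (While i c) s' u s''" "u \<le> (T + 1) * (n - Suc k) + 1" "I n s''"
    using Suc.hyps(1)[of "Suc k" s'] Suc.hyps(2) s'(3) k unfolding reaches_def
    by (metis Suc_diff_Suc Suc_leI diff_Suc_1)
  have "fst s i \<noteq> 0" using assms(3)[OF Suc.prems(1)] k by simp
  moreover have "t + u + 1 \<le> (T + 1) * (n - k) + 1"
  proof -
    have "n - k = Suc (n - Suc k)" using k by simp
    then show ?thesis using s'(2) s''(2) by simp
  qed
  ultimately show ?case using exec.WhileT[OF _ s'(1) s''(1)] s''(3) unfolding reaches_def by blast
qed

text \<open>The closing \<open>Skip\<close> costs one step, so \<open>m\<close> unit-cost
  instructions take \<open>m + 1\<close> steps; the time bounds below include it.\<close>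

fun block :: "prog list \<Rightarrow> prog" where
  "block [] = Skip"
| "block (c # cs) = Seq c (block cs)"


section \<open>The greedy vertex cover\<close>

text \<open>The number of edges at \<open>u\<close> counted with multiplicity. A loop counts once,
  through \<open>x = u\<close>, unlike in the degree of the random model.\<close>

definition row_sum :: "mgraph \<Rightarrow> nat \<Rightarrow> nat" where
  "row_sum G u = (\<Sum>x<fst G. count (edges G) {u, x})"

text \<open>
  Both endpoints of an uncovered edge are selected, unless the edge is a whole component:
  for an edge between \<open>u\<close> and \<open>v\<close> this is what \<open>row_sum G u + row_sum G v = 2\<close> means.
\<close>

definition greedy_step :: "mgraph \<Rightarrow> nat \<Rightarrow> nat \<Rightarrow> nat set \<Rightarrow> nat set" where
  "greedy_step G u v C =
     (if {u, v} \<in># edges G \<and> u \<notin> C \<and> v \<notin> C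
      then if row_sum G u + row_sum G v = 2 then insert u C else insert v (insert u C)
      else C)"

primrec greedy_row :: "mgraph \<Rightarrow> nat \<Rightarrow> nat \<Rightarrow> nat set \<Rightarrow> nat set" where
  "greedy_row G u 0 C = C"
| "greedy_row G u (Suc v) C = greedy_step G u v (greedy_row G u v C)"

primrec greedy :: "mgraph \<Rightarrow> nat \<Rightarrow> nat set" where
  "greedy G 0 = {}"
| "greedy G (Suc u) = greedy_row G u (fst G) (greedy G u)"

definition greedy_cover :: "mgraph \<Rightarrow> nat set" where
  "greedy_cover G = greedy G (fst G)"

section \<open>Row sums and edges that are whole components\<close>

lemma count_le_row_sum: "v < fst G \<Longrightarrow> count (edges G) {u, v} \<le> row_sum G u"
  unfolding row_sum_def by (rule member_le_sum) auto

lemma row_sum_ge_two: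
  assumes "{u, x} \<in># edges G" "{u, y} \<in># edges G" "x \<noteq> y" "x < fst G" "y < fst G"
  shows "2 \<le> row_sum G u"
proof -
  have "(\<Sum>z\<in>{x, y}. count (edges G) {u, z}) \<le> row_sum G u"
    unfolding row_sum_def using assms by (intro sum_mono2) auto
  moreover have "1 \<le> count (edges G) {u, x}" "1 \<le> count (edges G) {u, y}"
    using assms by (simp_all add: Suc_le_eq)
  moreover have "(\<Sum>z\<in>{x, y}. count (edges G) {u, z}) = count (edges G) {u, x} + count (edges G) {u, y}"
    using assms(3) by simp
  ultimately show ?thesis by linarith
qed

lemma multigraph_edgeE:
  assumes "multigraph G" "e \<in># edges G" "u \<in> e"
  obtains v where "e = {u, v}" "u < fst G" "v < fst G"
proof -
  have e: "e \<subseteq> {..<fst G}" "card e = 1 \<or> card e = 2"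
    using assms unfolding multigraph_def verts_def by auto
  from e(2) obtain v where "e = {u, v}"
  proof
    assume "card e = 1"
    then have "e = {u, u}" using assms(3) by (metis card_1_singletonE insert_absorb2 singletonD)
    then show ?thesis using that by blast
  next
    assume "card e = 2"
    then obtain x y where "e = {x, y}" by (meson card_2_iff)
    then show ?thesis using that assms(3) by (metis insert_commute insertE singletonD)
  qed
  with e(1) that show ?thesis by auto
qed

text \<open>The edge itself counts in both row sums, so a total of 2 forces each to be 1; a
  different edge at \<open>u\<close> or \<open>v\<close> would raise one of them to 2.\<close>

lemma edge_eq_if_row_sum_two:
  assumes G: "multigraph G" and e: "{u, v} \<in># edges G" "row_sum G u + row_sum G v = 2"
    and e': "e' \<in># edges G" "e' \<inter> {u, v} \<noteq> {}"
  shows "e' = {u, v}"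
proof -
  have uv: "u < fst G" "v < fst G" using G e(1) unfolding multigraph_def verts_def by force+
  have "1 \<le> row_sum G u" "1 \<le> row_sum G v"
    using e(1) count_le_row_sum[OF uv(2), of u] count_le_row_sum[OF uv(1), of v]
    by (simp_all add: Suc_le_eq insert_commute flip: count_greater_zero_iff)
  with e(2) have rs: "row_sum G u < 2" "row_sum G v < 2" by simp_all
  show ?thesis
  proof (cases "u \<in> e'")
    case True
    then obtain x where "e' = {u, x}" "x < fst G" using multigraph_edgeE[OF G e'(1)] by metis
    then show ?thesis using row_sum_ge_two[of u x G v] e' e uv rs by fastforce
  next
    case False
    then have "v \<in> e'" using e' by auto
    then obtain x where "e' = {v, x}" "x < fst G" using multigraph_edgeE[OF G e'(1)] by metis
    then show ?thesis using row_sum_ge_two[of v x G u] e' e uv rs by (fastforce simp: insert_commute)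
  qed
qed

definition isolated_edges :: "mgraph \<Rightarrow> nat set set" where
  "isolated_edges G =
     {e. e \<in># edges G \<and> (\<exists>u v. u \<noteq> v \<and> e = {u, v} \<and> row_sum G u + row_sum G v = 2)}"

text \<open>\<open>P\<close> is the matching formed by the edges at which vertices were selected.\<close>

definition greedy_inv :: "mgraph \<Rightarrow> (nat \<times> nat) set \<Rightarrow> nat set \<Rightarrow> nat set set \<Rightarrow> bool" where
  "greedy_inv G S C P \<longleftrightarrow>
     P \<subseteq> set_mset (edges G) \<and> disjoint P \<and> C \<subseteq> \<Union> P \<and>
     (\<forall>e\<in>P. e \<inter> C \<noteq> {} \<and> (e \<subseteq> C \<or> (\<forall>e'. e' \<in># edges G \<longrightarrow> e' \<inter> e \<noteq> {} \<longrightarrow> e' = e))) \<and>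
     (\<forall>e\<in>P \<inter> isolated_edges G. card (e \<inter> C) \<le> 1) \<and>
     (\<forall>(u, v)\<in>S. {u, v} \<in># edges G \<longrightarrow> {u, v} \<inter> C \<noteq> {})"

text \<open>The matching stays \<open>P\<close> if nothing is selected and gains the edge
  \<open>{u, v}\<close> otherwise.\<close>

lemma greedy_inv_step:
  assumes G: "multigraph G" and inv: "greedy_inv G S C P"
  shows "\<exists>P'. greedy_inv G (insert (u, v) S) (greedy_step G u v C) P'"
proof (cases "{u, v} \<in># edges G \<and> u \<notin> C \<and> v \<notin> C")
  case False
  then show ?thesis using inv by (intro exI[of _ P]) (auto simp: greedy_inv_def greedy_step_def)
next
  case True
  define e where "e = {u, v}"
  define C' where "C' = greedy_step G u v C"
  have e: "e \<in># edges G" "e \<inter> C = {}" using True by (auto simp: e_def)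
  \<comment> \<open>An earlier matching edge either lies inside \<open>C\<close>, which
    \<open>e\<close> avoids, or is met by no edge but itself. In the second case it would equal
    \<open>e\<close>, although every matching edge meets \<open>C\<close>.\<close>
  have disj: "e \<inter> p = {}" if "p \<in> P" for p
  proof (rule ccontr)
    assume "e \<inter> p \<noteq> {}"
    then have "p \<subseteq> C \<or> e = p" using inv that e unfolding greedy_inv_def by blast
    then show False using e(2) \<open>e \<inter> p \<noteq> {}\<close> inv that unfolding greedy_inv_def by blast
  qed
  have C': "C' = (if row_sum G u + row_sum G v = 2 then insert u C else e \<union> C)"
    using True by (auto simp: C'_def greedy_step_def e_def)
  have old: "p \<inter> C' = p \<inter> C" if "p \<in> P" for p
    using disj[OF that] by (auto simp: C' e_def)
  have "e \<notin> P" using disj by (auto simp: e_def)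
  have "greedy_inv G (insert (u, v) S) C' (insert e P)"
    unfolding greedy_inv_def
  proof (intro conjI)
    show "insert e P \<subseteq> set_mset (edges G)" using e inv by (auto simp: greedy_inv_def)
    show "disjoint (insert e P)"
      using inv disj by (auto simp: greedy_inv_def disjoint_def Int_commute)
    show "C' \<subseteq> \<Union> (insert e P)" using inv by (auto simp: greedy_inv_def C' e_def)
    show "\<forall>p\<in>insert e P. p \<inter> C' \<noteq> {} \<and>
        (p \<subseteq> C' \<or> (\<forall>e'. e' \<in># edges G \<longrightarrow> e' \<inter> p \<noteq> {} \<longrightarrow> e' = p))"
    proof
      fix p assume p: "p \<in> insert e P"
      show "p \<inter> C' \<noteq> {} \<and> (p \<subseteq> C' \<or> (\<forall>e'. e' \<in># edges G \<longrightarrow> e' \<inter> p \<noteq> {} \<longrightarrow> e' = p))"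
      proof (cases "p = e")
        case True
        moreover have "e \<inter> C' \<noteq> {}" by (auto simp: C' e_def)
        moreover have "e \<subseteq> C'" if "row_sum G u + row_sum G v \<noteq> 2" using that by (simp add: C')
        moreover have "e' = e" if "row_sum G u + row_sum G v = 2" "e' \<in># edges G" "e' \<inter> e \<noteq> {}" for e'
          using edge_eq_if_row_sum_two[OF G] that e(1) by (simp add: e_def)
        ultimately show ?thesis by blast
      next
        case False
        then have "p \<in> P" using p by simp
        then show ?thesis using inv old[of p] unfolding greedy_inv_def by (metis inf.absorb_iff1)
      qed
    qed
    show "\<forall>p\<in>insert e P \<inter> isolated_edges G. card (p \<inter> C') \<le> 1"
    proof
      fix p assume p: "p \<in> insert e P \<inter> isolated_edges G"
      show "card (p \<inter> C') \<le> 1"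
      proof (cases "p = e")
        case True
        \<comment> \<open>The endpoints of the isolated edge are \<open>u\<close> and
          \<open>v\<close>, so the test in \<open>greedy_step\<close> succeeded and only
          \<open>u\<close> was selected.\<close>
        then have "row_sum G u + row_sum G v = 2"
          using p by (auto simp: isolated_edges_def e_def doubleton_eq_iff)
        then have "p \<inter> C' \<subseteq> {u}" using True e(2) by (auto simp: C')
        then show ?thesis using card_mono[of "{u}"] by simp
      next
        case False
        then show ?thesis using p inv old[of p] by (auto simp: greedy_inv_def)
      qed
    qed
    show "\<forall>(x, y)\<in>insert (u, v) S. {x, y} \<in># edges G \<longrightarrow> {x, y} \<inter> C' \<noteq> {}"
      using inv by (auto simp: greedy_inv_def C' e_def)
  qed
  then show ?thesis unfolding C'_def by blast
qed

lemma greedy_inv_row: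
  assumes G: "multigraph G" and inv: "greedy_inv G S C P"
  shows "\<exists>P'. greedy_inv G (S \<union> {u} \<times> {..<v}) (greedy_row G u v C) P'"
proof (induction v)
  case 0
  then show ?case using inv by auto
next
  case (Suc v)
  have "S \<union> {u} \<times> {..<Suc v} = insert (u, v) (S \<union> {u} \<times> {..<v})" by (auto simp: less_Suc_eq)
  then show ?case using Suc greedy_inv_step[OF G] by fastforce
qed

lemma greedy_inv_greedy:
  assumes G: "multigraph G"
  shows "\<exists>P. greedy_inv G ({..<u} \<times> {..<fst G}) (greedy G u) P"
proof (induction u)
  case 0
  show ?case by (intro exI[of _ "{}"]) (simp add: greedy_inv_def disjoint_def)
next
  case (Suc u)
  have "{..<Suc u} \<times> {..<fst G} = {..<u} \<times> {..<fst G} \<union> {u} \<times> {..<fst G}"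
    by (auto simp: less_Suc_eq)
  then show ?case using Suc greedy_inv_row[OF G] by fastforce
qed

section \<open>Cover size compared with the optimum\<close>

lemma finite_vertex_covers: "finite {C. vertex_cover G C}"
  by (rule finite_subset[of _ "Pow (verts G)"]) (auto simp: vertex_cover_def verts_def)

lemma vertex_cover_verts:
  assumes "multigraph G" shows "vertex_cover G (verts G)"
  unfolding vertex_cover_def
proof (intro conjI ballI)
  fix e assume "e \<in># edges G"
  then have "e \<subseteq> verts G" "e \<noteq> {}" using assms unfolding multigraph_def by force+
  then show "e \<inter> verts G \<noteq> {}" by auto
qed simp

lemma vc_opt_le:
  assumes "multigraph G" shows "vc_opt G \<le> fst G"
proof -
  have "vc_opt G \<le> card (verts G)"
    unfolding vc_opt_def using vertex_cover_verts[OF assms] finite_vertex_covers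
    by (intro Min_le) auto
  then show ?thesis by (simp add: verts_def)
qed

text \<open>Weak duality: picking a covering vertex from each matching edge is injective because the
  edges are disjoint.\<close>

lemma matching_le_vc_opt:
  assumes "multigraph G" "P \<subseteq> set_mset (edges G)" "disjoint P"
  shows "card P \<le> vc_opt G"
proof -
  have "card P \<le> card C" if C: "vertex_cover G C" for C
  proof -
    have fin: "finite C" using C finite_subset unfolding vertex_cover_def verts_def by blast
    have "\<forall>e\<in>P. \<exists>x. x \<in> e \<inter> C" using C assms(2) unfolding vertex_cover_def by blast
    then obtain g where g: "\<And>e. e \<in> P \<Longrightarrow> g e \<in> e \<inter> C" by metis
    have "inj_on g P"
      using g assms(3) unfolding inj_on_def disjoint_def by (metis IntD1 IntI empty_iff)
    then show ?thesis using g fin by (intro card_inj_on_le) auto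
  qed
  then show ?thesis unfolding vc_opt_def
    using finite_vertex_covers vertex_cover_verts[OF assms(1)] by (subst Min_ge_iff) auto
qed

text \<open>All three facts come from the invariant after all pairs. An isolated edge belongs to
  \<open>P\<close>, since its selected vertex lies in an edge of \<open>P\<close>, which can only be
  the isolated edge itself. Each edge of \<open>P\<close> contributes at most two selected vertices,
  an isolated one at most one, and \<open>P\<close> has at most \<open>vc_opt G\<close>
  edges.\<close>

lemma
  assumes G: "multigraph G"
  shows vertex_cover_greedy: "vertex_cover G (greedy_cover G)"
    and card_greedy_cover: "card (greedy_cover G) + card (isolated_edges G) \<le> 2 * vc_opt G"
    and card_isolated_edges: "card (isolated_edges G) \<le> vc_opt G"
proof -
  define C where "C = greedy_cover G"
  obtain P where inv: "greedy_inv G ({..<fst G} \<times> {..<fst G}) C P"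
    using greedy_inv_greedy[OF G, of "fst G"] unfolding C_def greedy_cover_def by blast
  have P: "P \<subseteq> set_mset (edges G)" "disjoint P" "C \<subseteq> \<Union> P"
    using inv by (auto simp: greedy_inv_def)
  have fin: "finite P" using P(1) finite_subset by blast
  have card_e: "finite e" "card e \<le> 2" if "e \<in> P" for e
    using G P(1) that unfolding multigraph_def by (fastforce intro: card_ge_0_finite)+
  have covers: "e \<inter> C \<noteq> {}" if e: "e \<in># edges G" for e
  proof -
    have "e \<noteq> {}" using G e unfolding multigraph_def by fastforce
    then obtain u v where "e = {u, v}" "u < fst G" "v < fst G"
      using multigraph_edgeE[OF G e] by (metis all_not_in_conv)
    then show ?thesis using inv e unfolding greedy_inv_def by blast
  qed
  show "vertex_cover G (greedy_cover G)"
    using covers P G unfolding vertex_cover_def multigraph_def C_def by blast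
  have iso: "isolated_edges G \<subseteq> P"
  proof
    fix e assume e: "e \<in> isolated_edges G"
    then obtain x where x: "x \<in> e" "x \<in> C" using covers unfolding isolated_edges_def by blast
    then obtain p where p: "p \<in> P" "x \<in> p" using P(3) by blast
    then have "p = e"
      using edge_eq_if_row_sum_two[OF G] e P(1) x(1) unfolding isolated_edges_def by blast
    then show "e \<in> P" using p by simp
  qed
  then show "card (isolated_edges G) \<le> vc_opt G"
    using matching_le_vc_opt[OF G P(1,2)] card_mono[OF fin] by (meson le_trans)
  have "card C = card (\<Union>e\<in>P. e \<inter> C)" using P(3) by (intro arg_cong[of _ _ card]) auto
  also have "\<dots> \<le> (\<Sum>e\<in>P. card (e \<inter> C))" using fin by (rule card_UN_le)
  finally have "card C + card (isolated_edges G)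
      \<le> (\<Sum>e\<in>P. card (e \<inter> C) + (if e \<in> isolated_edges G then 1 else 0))"
    using iso fin by (simp add: sum.distrib flip: sum.inter_restrict) (simp add: Int_absorb1)
  also have "\<dots> \<le> (\<Sum>e\<in>P. 2)"
  proof (rule sum_mono)
    fix e assume e: "e \<in> P"
    have "card (e \<inter> C) \<le> 2" using card_mono[of e "e \<inter> C"] card_e[OF e] by simp
    moreover have "card (e \<inter> C) \<le> 1" if "e \<in> isolated_edges G"
      using inv e that by (simp add: greedy_inv_def)
    ultimately show "card (e \<inter> C) + (if e \<in> isolated_edges G then 1 else 0) \<le> 2"
      by simp
  qed
  also have "\<dots> \<le> 2 * vc_opt G" using matching_le_vc_opt[OF G P(1,2)] by simp
  finally show "card (greedy_cover G) + card (isolated_edges G) \<le> 2 * vc_opt G"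
    unfolding C_def .
qed

lemma approx_ratio_greedy_cover:
  assumes G: "multigraph G"
  shows "approx_ratio greedy_cover G \<le> 2 - card (isolated_edges G) / real (fst G)"
proof (cases "vc_opt G = 0")
  \<comment> \<open>Division by zero makes the ratio 0, and there are no isolated edges because the
    optimum bounds their number.\<close>
  case True
  then show ?thesis using card_isolated_edges[OF G] by (simp add: approx_ratio_def)
next
  case False
  let ?o = "real (vc_opt G)" and ?i = "real (card (isolated_edges G))"
  have "real (card (greedy_cover G)) + ?i \<le> 2 * ?o"
    using card_greedy_cover[OF G] by linarith
  then have "approx_ratio greedy_cover G \<le> 2 - ?i / ?o"
    using False by (simp add: approx_ratio_def field_simps)
  \<comment> \<open>The vertex count replaces the optimum because it is fixed by the degree
    sequence, which leaves only the number of isolated edges to be averaged.\<close>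
  also have "\<dots> \<le> 2 - ?i / fst G"
    using vc_opt_le[OF G] False by (simp add: frac_le)
  finally show ?thesis .
qed


section \<open>The greedy vertex cover on the machine\<close>

definition memory :: "mgraph \<Rightarrow> nat set \<Rightarrow> nat \<Rightarrow> nat" where
  "memory G C a = (let n = fst G in
     if a < n * n then count (edges G) {a div n, a mod n}
     else if a < n * n + n \<and> a - n * n \<in> C then 1 else 0)"

lemma memory_matrix:
  assumes "u < fst G" "v < fst G"
  shows "memory G C (u * fst G + v) = count (edges G) {u, v}"
proof -
  have "u * fst G + v < Suc u * fst G" using assms by simp
  also have "\<dots> \<le> fst G * fst G" using assms by (intro mult_le_mono1) simp
  finally show ?thesis using assms by (simp add: memory_def)
qed

lemma memory_flag:
  "v < fst G \<Longrightarrow> memory G C (fst G * fst G + v) = (if v \<in> C then 1 else 0)"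
  by (simp add: memory_def)

lemma memory_insert:
  "v < fst G \<Longrightarrow> (memory G C)(fst G * fst G + v := Suc 0) = memory G (insert v C)"
  by (auto simp: memory_def fun_eq_iff Let_def)

text \<open>Register use: 0 holds \<open>n\<close>, 1 holds 1, 2 collects \<open>n * n\<close>; 3
  and 4 hold \<open>u\<close> and \<open>u * n\<close>; 5 counts down the squaring loop and then the
  main loop; 6, 7, 8 hold \<open>v\<close>, \<open>v * n\<close>, \<open>n - v\<close>; 9
  accumulates both row sums, with index in 10 and countdown in 11; 12 to 17 are scratch. Products
  are kept as running sums since the machine cannot multiply.\<close>

definition square_body :: prog where
  "square_body = block [Add 2 2 0, Sub 5 5 1]"

definition sum_body :: prog where
  "sum_body = block [Add 12 4 10, Load 12 12, Add 9 9 12, Add 12 7 10, Load 12 12, Add 9 9 12,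
     Add 10 10 1, Sub 11 11 1]"

text \<open>Register 12 gets the multiplicity of \<open>{u, v}\<close>, 13 and 14 the addresses of
  the two selection flags, and 15 the sum of these flags, which is 0 iff both endpoints are
  unselected. Register 17 gets the truncated difference of the row sums and 2.\<close>

definition step_code :: prog where
  "step_code = block [Add 12 4 6, Load 12 12, Add 13 2 3, Add 14 2 6, Load 15 13, Load 16 14,
     Add 15 15 16,
     Cond 12
       (Cond 15 Skip
         (block [Store 13 1, Const 17 2, Sub 17 9 17, Cond 17 (Store 14 1) Skip]))
       Skip,
     Add 6 6 1, Add 7 7 0, Sub 8 8 1]"

definition row_body :: prog where
  "row_body = Seq (block [Const 9 0, Const 10 0, Add 11 0 10]) (Seq (While 11 sum_body) step_code)"

definition main_body :: prog where
  "main_body = Seq (block [Const 6 0, Const 7 0, Add 8 0 6])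
     (Seq (While 8 row_body) (block [Add 3 3 1, Add 4 4 0, Sub 5 5 1]))"

definition greedy_prog :: prog where
  "greedy_prog = Seq (block [Const 1 1, Add 5 0 2])
     (Seq (While 5 square_body) (Seq (Add 5 0 3) (While 5 main_body)))"

section \<open>Loop invariants and running time\<close>

definition main_inv :: "mgraph \<Rightarrow> nat \<Rightarrow> nat set \<Rightarrow> ram_state \<Rightarrow> bool" where
  "main_inv G u C s \<longleftrightarrow> (let n = fst G; R = fst s in
     R 0 = n \<and> R 1 = 1 \<and> R 2 = n * n \<and> R 3 = u \<and> R 4 = u * n \<and> R 5 = n - u \<and>
     snd s = memory G C)"

definition row_inv :: "mgraph \<Rightarrow> nat \<Rightarrow> nat \<Rightarrow> nat set \<Rightarrow> ram_state \<Rightarrow> bool" where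
  "row_inv G u v C s \<longleftrightarrow> (let n = fst G; R = fst s in
     main_inv G u C s \<and> R 6 = v \<and> R 7 = v * n \<and> R 8 = n - v)"

definition sum_inv :: "mgraph \<Rightarrow> nat \<Rightarrow> nat \<Rightarrow> nat set \<Rightarrow> nat \<Rightarrow> ram_state \<Rightarrow> bool" where
  "sum_inv G u v C w s \<longleftrightarrow> (let n = fst G; R = fst s in
     row_inv G u v C s \<and>
     R 9 = (\<Sum>x<w. count (edges G) {u, x} + count (edges G) {v, x}) \<and> R 10 = w \<and> R 11 = n - w)"

lemmas inv_defs = main_inv_def row_inv_def sum_inv_def Let_def

lemma inv_counters:
  "main_inv G u C s \<Longrightarrow> fst s 5 = fst G - u"
  "row_inv G u v C s \<Longrightarrow> fst s 8 = fst G - v"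
  "sum_inv G u v C w s \<Longrightarrow> fst s 11 = fst G - w"
  by (simp_all add: inv_defs)

lemma sum_body:
  assumes "sum_inv G u v C w s" "u < fst G" "v < fst G" "w < fst G"
  shows "reaches sum_body s 9 (sum_inv G u v C (Suc w))"
  using assms
  by (cases s, intro reaches_loopfree) (simp_all add: sum_body_def inv_defs memory_matrix)

lemma step_code:
  assumes "sum_inv G u v C (fst G) s" "u < fst G" "v < fst G"
  shows "reaches step_code s 22 (row_inv G u (Suc v) (greedy_step G u v C))"
proof -
  \<comment> \<open>The program tests whether the sum exceeds 2, \<open>greedy_step\<close> whether
    it differs from 2. These agree because an edge between \<open>u\<close> and \<open>v\<close>
    counts in both row sums.\<close>
  have ge: "row_sum G u + row_sum G v \<ge> 2" if "{u, v} \<in># edges G"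
  proof -
    have "1 \<le> count (edges G) {u, v}" "count (edges G) {v, u} = count (edges G) {u, v}"
      using that by (auto simp: Suc_le_eq insert_commute)
    then show ?thesis
      using count_le_row_sum[OF assms(3), of u] count_le_row_sum[OF assms(2), of v] by linarith
  qed
  obtain R where s: "s = (R, memory G C)"
    using assms(1) by (cases s) (simp add: inv_defs)
  have R: "R 0 = fst G" "R 1 = 1" "R 2 = fst G * fst G" "R 3 = u" "R 4 = u * fst G"
    "R 5 = fst G - u" "R 6 = v" "R 7 = v * fst G" "R 8 = fst G - v"
    "R 9 = row_sum G u + row_sum G v"
    using assms(1) by (simp_all add: s inv_defs row_sum_def sum.distrib)
  have "row_inv G u (Suc v) (greedy_step G u v C) (sem step_code s)"
  proof (cases "{u, v} \<in># edges G \<and> u \<notin> C \<and> v \<notin> C")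
    case True
    then have "greedy_step G u v C =
        (if row_sum G u + row_sum G v \<le> 2 then insert u C else insert v (insert u C))"
      using ge by (auto simp: greedy_step_def)
    moreover have "count (edges G) {u, v} \<noteq> 0" using True by simp
    ultimately show ?thesis
      using R True assms(2,3)
      by (simp add: s step_code_def inv_defs memory_matrix memory_flag memory_insert
          del: count_greater_zero_iff)
  next
    case False
    then have "greedy_step G u v C = C" by (auto simp: greedy_step_def)
    moreover have "count (edges G) {u, v} = 0 \<or> u \<in> C \<or> v \<in> C"
      using False by (auto simp: not_in_iff)
    ultimately show ?thesis
      using R assms(2,3)
      by (elim disjE) (simp_all add: s step_code_def inv_defs memory_matrix memory_flag)
  qed
  then show ?thesis by (intro reaches_loopfree) (simp_all add: step_code_def)
qed

lemma row_body:
  assumes "row_inv G u v C s" "u < fst G" "v < fst G"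
  shows "reaches row_body s (10 * fst G + 27) (row_inv G u (Suc v) (greedy_step G u v C))"
proof -
  let ?init = "block [Const 9 0, Const 10 0, Add 11 0 10]"
  have init: "reaches ?init s 4 (sum_inv G u v C 0)"
    using assms by (cases s, intro reaches_loopfree) (simp_all add: inv_defs)
  have loop: "reaches (While 11 sum_body) s' (10 * fst G + 1) (sum_inv G u v C (fst G))"
    if "sum_inv G u v C 0 s'" for s'
    using reaches_While[OF that _ inv_counters(3) sum_body[OF _ assms(2,3)]] by simp
  have "reaches row_body s (4 + (10 * fst G + 1 + 22))
      (row_inv G u (Suc v) (greedy_step G u v C))"
    unfolding row_body_def
    by (rule reaches_Seq[OF init reaches_Seq[OF loop step_code[OF _ assms(2,3)]]])
  then show ?thesis by (simp add: algebra_simps)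
qed

lemma main_body:
  assumes "main_inv G u (greedy G u) s" "u < fst G"
  shows "reaches main_body s ((10 * fst G + 28) * fst G + 9) (main_inv G (Suc u) (greedy G (Suc u)))"
proof -
  let ?init = "block [Const 6 0, Const 7 0, Add 8 0 6]"
  let ?final = "block [Add 3 3 1, Add 4 4 0, Sub 5 5 1]"
  let ?I = "\<lambda>v. row_inv G u v (greedy_row G u v (greedy G u))"
  have init: "reaches ?init s 4 (?I 0)"
    using assms by (cases s, intro reaches_loopfree) (simp_all add: inv_defs)
  have counter: "fst s 8 = fst G - v" if "?I v s" for v s
    using that by (rule inv_counters)
  have body: "reaches row_body s (10 * fst G + 27) (?I (Suc v))" if "?I v s" "v < fst G" for v s
    using row_body[OF that(1) assms(2) that(2)] by simp
  have loop: "reaches (While 8 row_body) s' ((10 * fst G + 28) * fst G + 1) (?I (fst G))"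
    if "?I 0 s'" for s'
    using reaches_While[of ?I 0 s' "fst G", OF that _ counter body] by (simp add: algebra_simps)
  have final: "reaches ?final s' 4 (main_inv G (Suc u) (greedy G (Suc u)))"
    if "?I (fst G) s'" for s'
    using that by (cases s', intro reaches_loopfree) (simp_all add: inv_defs)
  have "reaches main_body s
      (4 + ((10 * fst G + 28) * fst G + 1 + 4))
      (main_inv G (Suc u) (greedy G (Suc u)))"
    unfolding main_body_def by (rule reaches_Seq[OF init reaches_Seq[OF loop final]])
  then show ?thesis by (simp add: algebra_simps)
qed

lemma greedy_prog:
  "reaches greedy_prog (ram_input G) (((10 * fst G + 28) * fst G + 10) * fst G + 4 * fst G + 6)
     (main_inv G (fst G) (greedy_cover G))"
proof -
  let ?n = "fst G"
  let ?init = "block [Const 1 1, Add 5 0 2]"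
  \<comment> \<open>The state after \<open>k\<close> rounds of the squaring loop, each of which adds
    \<open>n\<close> to register 2.\<close>
  define J where "J k s \<longleftrightarrow> fst s 0 = ?n \<and> fst s 1 = 1 \<and> fst s 2 = k * ?n \<and> fst s 3 = 0 \<and>
    fst s 4 = 0 \<and> fst s 5 = ?n - k \<and> snd s = memory G {}" for k and s :: ram_state
  let ?I = "\<lambda>u. main_inv G u (greedy G u)"
  have init: "reaches ?init (ram_input G) 3 (J 0)"
    by (intro reaches_loopfree) (simp_all add: J_def ram_input_def memory_def Let_def fun_eq_iff)
  have body: "reaches square_body s 3 (J (Suc k))" if "J k s" "k < ?n" for k s
    using that by (cases s, intro reaches_loopfree) (simp_all add: J_def square_body_def)
  have square: "reaches (While 5 square_body) s (4 * ?n + 1) (J ?n)" if "J 0 s" for s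
    using reaches_While[of J, OF that _ _ body] by (simp add: J_def)
  have reset: "reaches (Add 5 0 3) s 1 (?I 0)" if "J ?n s" for s
    using that by (cases s, intro reaches_loopfree) (simp_all add: inv_defs J_def)
  have counter: "fst s 5 = ?n - u" if "?I u s" for u s
    using that by (rule inv_counters)
  have main: "reaches (While 5 main_body) s (((10 * ?n + 28) * ?n + 10) * ?n + 1) (?I ?n)"
    if "?I 0 s" for s
    using reaches_While[of ?I 0 s ?n, OF that _ counter main_body] by (simp add: algebra_simps)
  have "reaches greedy_prog (ram_input G) (3 + (4 * ?n + 1 +
      (1 + (((10 * ?n + 28) * ?n + 10) * ?n + 1)))) (?I ?n)"
    unfolding greedy_prog_def
    by (rule reaches_Seq[OF init reaches_Seq[OF square reaches_Seq[OF reset main]]])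
  then show ?thesis by (simp add: greedy_cover_def algebra_simps)
qed

lemma poly_nat_mono: "x \<le> y \<Longrightarrow> poly p x \<le> poly p (y :: nat)"
  by (induction p) (auto intro: add_mono mult_mono)

lemma poly_time_greedy_cover: "poly_time_computable greedy_cover"
  unfolding poly_time_computable_def
proof (rule exI[of _ greedy_prog], rule exI[of _ "[:6, 14, 28, 10:]"], intro allI impI)
  fix G assume G: "multigraph G"
  \<comment> \<open>The coefficients of the bound in \<open>greedy_prog\<close> after expansion: 10
    n^3 + 28 n^2 + (10 + 4) n + 6.\<close>
  let ?p = "[:6, 14, 28, 10:] :: nat poly"
  obtain t s where s: "exec greedy_prog (ram_input G) t s" "main_inv G (fst G) (greedy_cover G) s"
    and "t \<le> ((10 * fst G + 28) * fst G + 10) * fst G + 4 * fst G + 6"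
    using greedy_prog unfolding reaches_def by blast
  then have "t \<le> poly ?p (fst G)" by (simp add: algebra_simps)
  also have "\<dots> \<le> poly ?p (card (verts G) + size (edges G))"
    by (rule poly_nat_mono) (simp add: verts_def)
  finally have "t \<le> poly ?p (card (verts G) + size (edges G))" .
  \<comment> \<open>A vertex cover contains only vertices below \<open>n\<close>, so the flags read
    by \<open>ram_output\<close> capture all of it.\<close>
  moreover have "ram_output G s = greedy_cover G"
    using s(2) vertex_cover_greedy[OF G]
    by (auto simp: ram_output_def inv_defs memory_flag vertex_cover_def verts_def split: if_splits)
  ultimately show "\<exists>t s. exec greedy_prog (ram_input G) t s \<and>
      t \<le> poly ?p (card (verts G) + size (edges G)) \<and> ram_output G s = greedy_cover G"
    using s(1) by blast
qed


section \<open>Uniform perfect matchings\<close>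

lemma perfect_matchings_image_transpose:
  assumes "b \<in> S" "c \<in> S" "M \<in> perfect_matchings S"
  shows "(\<lambda>p. Transposition.transpose b c ` p) ` M \<in> perfect_matchings S"
proof -
  let ?t = "Transposition.transpose b c"
  have inj: "inj ?t" by simp
  have "?t ` S = S" using assms(1,2) by (auto simp: transpose_image_eq)
  moreover have "partition_on (?t ` S) ((`) ?t ` M - {{}})"
    using assms(3) inj unfolding perfect_matchings_def
    by (intro partition_on_transform) (auto simp: disjnt_def dest!: injD[OF inj])
  moreover have "{} \<notin> (`) ?t ` M"
    using assms(3) by (auto simp: perfect_matchings_def partition_on_def)
  moreover have "card (?t ` p) = card p" for p
    by (rule card_image) (rule inj_on_subset[OF inj], simp)
  ultimately show ?thesis
    using assms(3) by (auto simp: perfect_matchings_def)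
qed

text \<open>Swapping \<open>b\<close> and \<open>c\<close> throughout a matching is injective and
  turns the pair \<open>{a, b}\<close> into \<open>{a, c}\<close>. Exchanging the roles of
  \<open>b\<close> and \<open>c\<close> later gives equality.\<close>

lemma card_matchings_containing_le:
  assumes S: "finite S" "a \<in> S" "b \<in> S" "c \<in> S" "a \<noteq> b" "a \<noteq> c"
  shows "card {M \<in> perfect_matchings S. {a, b} \<in> M} \<le> card {M \<in> perfect_matchings S. {a, c} \<in> M}"
proof (rule card_inj_on_le)
  let ?f = "\<lambda>M. (\<lambda>p. Transposition.transpose b c ` p) ` M"
  show "inj_on ?f {M \<in> perfect_matchings S. {a, b} \<in> M}"
    by (rule inj_on_image, rule inj_on_image) (rule inj_on_subset[OF inj_transpose subset_UNIV])
  show "?f ` {M \<in> perfect_matchings S. {a, b} \<in> M} \<subseteq> {M \<in> perfect_matchings S. {a, c} \<in> M}"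
  proof (rule image_subsetI)
    fix M assume "M \<in> {M \<in> perfect_matchings S. {a, b} \<in> M}"
    then have M: "M \<in> perfect_matchings S" "{a, b} \<in> M" by auto
    have "Transposition.transpose b c ` {a, b} \<in> ?f M" using M(2) by (rule imageI)
    moreover have "Transposition.transpose b c ` {a, b} = {a, c}" using assms by simp
    ultimately show "?f M \<in> {M \<in> perfect_matchings S. {a, c} \<in> M}"
      using perfect_matchings_image_transpose[OF S(3,4) M(1)] by simp
  qed
  show "finite {M \<in> perfect_matchings S. {a, c} \<in> M}" using finite_perfect_matchings[OF S(1)] by simp
qed

lemma perfect_matching_partner:
  assumes "M \<in> perfect_matchings S" "a \<in> S"
  shows "card {b \<in> S - {a}. {a, b} \<in> M} = 1"
proof -
  obtain p where p: "p \<in> M" "a \<in> p" "card p = 2" "p \<subseteq> S"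
    using assms unfolding perfect_matchings_def partition_on_def by blast
  then obtain b where b: "p = {a, b}" "a \<noteq> b"
    by (metis card_2_iff doubleton_eq_iff insertE singletonD)
  have "q = p" if "q \<in> M" "a \<in> q" for q
    using assms(1) p that unfolding perfect_matchings_def partition_on_def disjoint_def by blast
  then have "x = b" if "{a, x} \<in> M" for x using that b by (metis doubleton_eq_iff insertI1)
  then have "{x \<in> S - {a}. {a, x} \<in> M} = {b}" using p b by blast
  then show ?thesis by simp
qed

text \<open>Double counting: each matching gives \<open>a\<close> exactly one partner among the
  \<open>card S - 1\<close> other elements, and by symmetry each partner occurs equally often. This
  is the probability \<open>1 / (card S - 1)\<close> of a given pair.\<close>

lemma card_matchings_containing:
  assumes S: "finite S" "p \<subseteq> S" "card p = 2"
  shows "card {M \<in> perfect_matchings S. p \<in> M} * (card S - 1) = card (perfect_matchings S)"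
proof -
  let ?PM = "perfect_matchings S"
  obtain a c where p: "p = {a, c}" "a \<noteq> c" using S(3) by (meson card_2_iff)
  have fin: "finite ?PM" using finite_perfect_matchings S(1) .
  have "card ?PM = (\<Sum>M\<in>?PM. card {b \<in> S - {a}. {a, b} \<in> M})"
    using perfect_matching_partner[of _ S a] p S(2) by simp
  also have "\<dots> = (\<Sum>M\<in>?PM. \<Sum>b\<in>S - {a}. if {a, b} \<in> M then 1 else 0)"
    using S(1) by (simp flip: sum.inter_filter)
  also have "\<dots> = (\<Sum>b\<in>S - {a}. \<Sum>M\<in>?PM. if {a, b} \<in> M then 1 else 0)"
    by (rule sum.swap)
  also have "\<dots> = (\<Sum>b\<in>S - {a}. card {M \<in> ?PM. {a, b} \<in> M})"
    using fin by (simp flip: sum.inter_filter)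
  also have "\<dots> = (\<Sum>b\<in>S - {a}. card {M \<in> ?PM. p \<in> M})"
  proof (rule sum.cong)
    fix b assume "b \<in> S - {a}"
    then show "card {M \<in> ?PM. {a, b} \<in> M} = card {M \<in> ?PM. p \<in> M}"
      using card_matchings_containing_le[of S a b c] card_matchings_containing_le[of S a c b] S p
      by (auto intro!: antisym)
  qed simp
  also have "\<dots> = card {M \<in> ?PM. p \<in> M} * (card S - 1)"
    using S p by (simp add: card_Diff_singleton)
  finally show ?thesis by simp
qed

text \<open>Linearity of expectation, multiplied out so that it stays within the natural
  numbers.\<close>

lemma sum_card_matching_pairs_within:
  assumes S: "finite S" "L \<subseteq> S"
  shows "(\<Sum>M\<in>perfect_matchings S. card {p \<in> M. p \<subseteq> L}) * (card S - 1) =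
    (card L choose 2) * card (perfect_matchings S)"
proof -
  let ?PM = "perfect_matchings S" and ?Q = "{p. p \<subseteq> L \<and> card p = 2}"
  have finL: "finite L" using S finite_subset by blast
  then have finQ: "finite ?Q" by simp
  have "(\<Sum>M\<in>?PM. card {p \<in> M. p \<subseteq> L}) = (\<Sum>M\<in>?PM. card {p \<in> ?Q. p \<in> M})"
    by (intro sum.cong arg_cong[of _ _ card]) (auto simp: perfect_matchings_def)
  also have "\<dots> = (\<Sum>M\<in>?PM. \<Sum>p\<in>?Q. if p \<in> M then 1 else 0)"
    using finQ by (simp flip: sum.inter_filter)
  also have "\<dots> = (\<Sum>p\<in>?Q. \<Sum>M\<in>?PM. if p \<in> M then 1 else 0)"
    by (rule sum.swap)
  also have "\<dots> = (\<Sum>p\<in>?Q. card {M \<in> ?PM. p \<in> M})"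
    using finite_perfect_matchings[OF S(1)] by (simp flip: sum.inter_filter)
  finally have "(\<Sum>M\<in>?PM. card {p \<in> M. p \<subseteq> L}) * (card S - 1) =
      (\<Sum>p\<in>?Q. card {M \<in> ?PM. p \<in> M} * (card S - 1))"
    by (simp add: sum_distrib_right)
  also have "\<dots> = (\<Sum>p\<in>?Q. card ?PM)"
    using S by (intro sum.cong card_matchings_containing) auto
  also have "\<dots> = (card L choose 2) * card ?PM" using n_subsets[OF finL, of 2] by simp
  finally show ?thesis .
qed


section \<open>Numerical estimates\<close>

lemma summable_zeta: "1 < s \<Longrightarrow> summable (\<lambda>n. 1 / real (Suc n) powr s)"
  using summable_Suc_iff[of "\<lambda>n. of_nat n powr - s :: real"] summable_real_powr_iff[of "- s"]
  by (simp add: powr_minus_divide)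

lemma sum_le_zeta:
  assumes "1 < s" shows "(\<Sum>i = 1..n. 1 / real i powr s) \<le> zeta s"
proof -
  have "(\<Sum>i = 1..n. 1 / real i powr s) = (\<Sum>i<n. 1 / real (Suc i) powr s)"
    by (rule sum.reindex_bij_witness[of _ Suc "\<lambda>i. i - 1"]) auto
  also have "\<dots> \<le> zeta s"
    unfolding zeta_def using summable_zeta[OF assms] by (intro sum_le_suminf) auto
  finally show ?thesis .
qed

lemma zeta_ge_1: "1 < s \<Longrightarrow> 1 \<le> zeta s"
  using sum_le_zeta[of s 1] by simp

text \<open>The bound comes from the telescoping majorant
  \<open>1 / x\<^sup>2 \<le> 1 / (x - 1 / 2) - 1 / (x + 1 / 2)\<close>.\<close>

lemma zeta_tail_le:
  assumes "2 \<le> s" shows "zeta s - 1 - 1 / 2 powr s \<le> 2 / 5"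
proof -
  let ?f = "\<lambda>n. 1 / real (Suc n) powr s"
  \<comment> \<open>Here x = n + 3, as the first two terms of the series are split off; the majorant
    then telescopes to \<open>?g 0\<close>, which is 2 / 5.\<close>
  let ?g = "\<lambda>n. 1 / (real n + 5 / 2)"
  have sf: "summable ?f" using assms by (intro summable_zeta) simp
  have "?g \<longlonglongrightarrow> 0" by real_asymp
  then have sg: "(\<lambda>n. ?g n - ?g (Suc n)) sums (?g 0 - 0)" by (rule telescope_sums')
  have le: "?f (n + 2) \<le> ?g n - ?g (Suc n)" for n
  proof -
    have "real (n + 3) powr 2 \<le> real (n + 3) powr s" using assms by (intro powr_mono) auto
    then have "?f (n + 2) \<le> 1 / (real n + 3) ^ 2"
      by (simp add: add.commute frac_le)
    also have "\<dots> \<le> ?g n - ?g (Suc n)"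
      by (simp add: divide_simps power2_eq_square) (simp add: algebra_simps)
    finally show ?thesis .
  qed
  have "zeta s = (\<Sum>n. ?f (n + 2)) + (\<Sum>n<2. ?f n)"
    unfolding zeta_def by (rule suminf_split_initial_segment[OF sf])
  also have "(\<Sum>n. ?f (n + 2)) \<le> (\<Sum>n. ?g n - ?g (Suc n))"
    using sf sg le by (intro suminf_le summable_ignore_initial_segment) (auto simp: sums_iff)
  also have "\<dots> = 2 / 5" using sg by (simp add: sums_iff)
  finally show ?thesis by (simp add: numeral_2_eq_2)
qed

lemma ratio_gain_le:
  assumes "2 < \<beta>"
  shows "(zeta \<beta> - 1 - 1 / 2 powr \<beta>) / (2 powr \<beta> * zeta (\<beta> - 1) * zeta \<beta>)
    \<le> 1 / (10 * zeta (\<beta> - 1) * zeta \<beta>)"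
proof -
  have "(2 :: real) powr 2 \<le> 2 powr \<beta>" using assms by (intro powr_mono) auto
  then have "(zeta \<beta> - 1 - 1 / 2 powr \<beta>) / 2 powr \<beta> \<le> (2 / 5) / 4"
    using zeta_tail_le[of \<beta>] assms by (intro frac_le) auto
  moreover have "0 < zeta (\<beta> - 1) * zeta \<beta>"
    using zeta_ge_1[of \<beta>] zeta_ge_1[of "\<beta> - 1"] assms by (intro mult_pos_pos) auto
  ultimately have "(zeta \<beta> - 1 - 1 / 2 powr \<beta>) / 2 powr \<beta> / (zeta (\<beta> - 1) * zeta \<beta>)
      \<le> (1 / 10) / (zeta (\<beta> - 1) * zeta \<beta>)"
    by (intro divide_right_mono) auto
  then show ?thesis by (simp add: mult.assoc)
qed

section \<open>Vertex and degree counts of the model\<close>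

lemma base_count_le:
  assumes "0 < i" shows "real (base_count \<alpha> \<beta> i) \<le> exp \<alpha> * (1 / real i powr \<beta>)"
  using assms by (auto simp: base_count_def)

lemma sum_base_count_le:
  assumes "1 < \<beta>"
  shows "real (\<Sum>i = 1..n. base_count \<alpha> \<beta> i) \<le> exp \<alpha> * zeta \<beta>"
proof -
  have "real (\<Sum>i = 1..n. base_count \<alpha> \<beta> i) \<le> (\<Sum>i = 1..n. exp \<alpha> * (1 / real i powr \<beta>))"
    unfolding of_nat_sum by (intro sum_mono base_count_le) auto
  also have "\<dots> = exp \<alpha> * (\<Sum>i = 1..n. 1 / real i powr \<beta>)" by (rule sum_distrib_left[symmetric])
  also have "\<dots> \<le> exp \<alpha> * zeta \<beta>" using sum_le_zeta[OF assms] by (intro mult_left_mono) auto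
  finally show ?thesis .
qed

lemma sum_degree_base_count_le:
  assumes "2 < \<beta>"
  shows "real (\<Sum>i = 1..n. i * base_count \<alpha> \<beta> i) \<le> exp \<alpha> * zeta (\<beta> - 1)"
proof -
  have "real (\<Sum>i = 1..n. i * base_count \<alpha> \<beta> i)
      \<le> (\<Sum>i = 1..n. exp \<alpha> * (1 / real i powr (\<beta> - 1)))"
    unfolding of_nat_sum of_nat_mult
  proof (rule sum_mono)
    fix i assume "i \<in> {1..n}"
    then have "real i * real (base_count \<alpha> \<beta> i) \<le> real i * (exp \<alpha> * (1 / real i powr \<beta>))"
      by (intro mult_left_mono base_count_le) auto
    also have "\<dots> = exp \<alpha> * (1 / real i powr (\<beta> - 1))"
      using \<open>i \<in> {1..n}\<close> by (simp add: powr_diff)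
    finally show "real i * real (base_count \<alpha> \<beta> i) \<le> exp \<alpha> * (1 / real i powr (\<beta> - 1))" .
  qed
  also have "\<dots> = exp \<alpha> * (\<Sum>i = 1..n. 1 / real i powr (\<beta> - 1))"
    by (rule sum_distrib_left[symmetric])
  also have "\<dots> \<le> exp \<alpha> * zeta (\<beta> - 1)"
    using sum_le_zeta[of "\<beta> - 1"] assms by (intro mult_left_mono) auto
  finally show ?thesis .
qed

text \<open>For small \<open>\<alpha>\<close> only degree 1 survives the rounding, which determines
  the parity of the degree sum there.\<close>

lemma base_count_eq_0:
  assumes "exp \<alpha> < 2" "1 \<le> \<beta>" "1 < i" shows "base_count \<alpha> \<beta> i = 0"
proof -
  have "real i powr 1 \<le> real i powr \<beta>" using assms by (intro powr_mono) auto
  then have "2 \<le> real i powr \<beta>" using assms(3) by simp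
  then have "exp \<alpha> / real i powr \<beta> < 1" using assms(1) by (simp add: divide_less_eq)
  then have "\<lfloor>exp \<alpha> / real i powr \<beta>\<rfloor> \<le> 0" by linarith
  then show ?thesis by (simp add: base_count_def)
qed

definition num_vertices :: "real \<Rightarrow> real \<Rightarrow> nat" where
  "num_vertices \<alpha> \<beta> = (\<Sum>i = 1..max_degree \<alpha> \<beta>. deg_count \<alpha> \<beta> i)"

definition degree_sum :: "real \<Rightarrow> real \<Rightarrow> nat" where
  "degree_sum \<alpha> \<beta> = (\<Sum>i = 1..max_degree \<alpha> \<beta>. i * deg_count \<alpha> \<beta> i)"

text \<open>With \<open>N\<close> the integer part of \<open>exp \<alpha>\<close>, the numbers of
  vertices and copies before parity correction are at most \<open>(N + 1) * z\<close> and
  \<open>(N + 1) * w\<close>. The zeta values then cancel, leaving an elementary inequality in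
  \<open>N\<close> for each parity of the degree sum.\<close>

lemma isolated_pairs_bound:
  assumes "0 < \<alpha>" "2 < \<beta>"
  defines "k \<equiv> deg_count \<alpha> \<beta> 1"
  shows "real (num_vertices \<alpha> \<beta>) / (10 * zeta (\<beta> - 1) * zeta \<beta>)
    \<le> real (k choose 2) / real (degree_sum \<alpha> \<beta> - 1)"
proof -
  let ?\<Delta> = "max_degree \<alpha> \<beta>" and ?y = "base_count \<alpha> \<beta>"
  define V where "V = (\<Sum>i = 1..?\<Delta>. ?y i)"
  define D where "D = (\<Sum>i = 1..?\<Delta>. i * ?y i)"
  define N where "N = nat \<lfloor>exp \<alpha>\<rfloor>"
  define z w where "z = zeta \<beta>" and "w = zeta (\<beta> - 1)"
  have z: "1 \<le> z" and w: "1 \<le> w" using zeta_ge_1 assms by (auto simp: z_def w_def)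
  have "1 < exp \<alpha>" using assms by simp
  then have N: "1 \<le> N" "exp \<alpha> \<le> N + 1" "N = 1 \<Longrightarrow> exp \<alpha> < 2"
    unfolding N_def by linarith+
  have y1: "?y 1 = N" using base_count_1 assms by (simp add: N_def)
  have split: "(\<Sum>i = 1..?\<Delta>. f i) = f 1 + (\<Sum>i = 2..?\<Delta>. f i)" for f :: "nat \<Rightarrow> nat"
    using split_off_degree_1 assms by simp
  have "V \<le> exp \<alpha> * z" unfolding V_def z_def using assms by (intro sum_base_count_le) simp
  also have "\<dots> \<le> (N + 1) * z" using N(2) z by (intro mult_right_mono) auto
  finally have V: "V \<le> (N + 1) * z" .
  have "D \<le> exp \<alpha> * w" unfolding D_def w_def using assms(2) by (rule sum_degree_base_count_le)
  also have "\<dots> \<le> (N + 1) * w" using N(2) w by (intro mult_right_mono) auto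
  finally have D: "D \<le> (N + 1) * w" .
  \<comment> \<open>Keeps the denominators \<open>D - 1\<close> (even case, where \<open>N\<close>
    is at least 2) and \<open>D\<close> (odd case) positive.\<close>
  have "N \<le> D" using split[of "\<lambda>i. i * ?y i"] y1 by (simp add: D_def)
  have choose: "real (m choose 2) = real m * (real m - 1) / 2" for m
    by (induction m) (simp_all add: numeral_2_eq_2 field_simps)
  have "real (num_vertices \<alpha> \<beta>) / (10 * w * z) \<le> real (k choose 2) / real (degree_sum \<alpha> \<beta> - 1)"
  proof (cases "even D")
    case True
    then have deg: "deg_count \<alpha> \<beta> i = ?y i" for i by (simp add: deg_count_def D_def)
    \<comment> \<open>If \<open>N\<close> were 1, there would be a single vertex, of degree 1, and
      \<open>D\<close> would be odd.\<close>
    have "N \<noteq> 1"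
    proof
      assume "N = 1"
      then have "(\<Sum>i = 2..?\<Delta>. i * ?y i) = 0"
        using base_count_eq_0[of \<alpha> \<beta>] N(3) assms by (intro sum.neutral) auto
      then have "D = 1" using split[of "\<lambda>i. i * ?y i"] y1 \<open>N = 1\<close> by (simp add: D_def)
      then show False using True by simp
    qed
    with N(1) have N2: "2 \<le> N" by simp
    have eqs: "num_vertices \<alpha> \<beta> = V" "degree_sum \<alpha> \<beta> = D" "k = N"
      using y1 by (simp_all add: num_vertices_def degree_sum_def deg V_def D_def k_def)
    have "real V / (10 * w * z) \<le> ((N + 1) * z) / (10 * w * z)"
      using V w z by (intro divide_right_mono) auto
    also have "\<dots> = (N + 1) / (10 * w)" using z by simp
    also have "\<dots> \<le> N * (N - 1) / 2 / ((N + 1) * w)"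
    proof -
      \<comment> \<open>The tightest case is N = 2, where this reads 9 <= 10. The product used in
        the proof is one less than the difference of the two sides.\<close>
      have "(real N + 1) * (real N + 1) \<le> 5 * (real N * (real N - 1))"
      proof -
        have "0 \<le> (real N - 2) * (4 * real N + 1)" using N2 by (intro mult_nonneg_nonneg) auto
        then show ?thesis by (simp add: algebra_simps)
      qed
      then show ?thesis using w N2 by (simp add: divide_simps of_nat_diff) (simp add: algebra_simps)
    qed
    also have "\<dots> \<le> N * (N - 1) / 2 / real (D - 1)"
      using D \<open>N \<le> D\<close> N2 by (intro divide_left_mono) auto
    finally show ?thesis using N2 by (simp add: eqs choose of_nat_diff)
  next
    case False
    then have deg: "deg_count \<alpha> \<beta> i = (if i = 1 then N + 1 else ?y i)" if "1 \<le> i" for i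
      using that by (auto simp: deg_count_def D_def N_def)
    have eqs: "num_vertices \<alpha> \<beta> = V + 1" "degree_sum \<alpha> \<beta> = D + 1" "k = N + 1"
      using split[of "deg_count \<alpha> \<beta>"] split[of ?y] split[of "\<lambda>i. i * deg_count \<alpha> \<beta> i"]
        split[of "\<lambda>i. i * ?y i"] y1
      by (simp_all add: num_vertices_def degree_sum_def deg V_def D_def k_def)
    \<comment> \<open>The extra vertex of degree 1 raises the leaf count to \<open>N + 1\<close> and
      the degree sum to \<open>D + 1\<close>, so the denominator becomes \<open>D\<close>; the added
      1 in the vertex count is absorbed by \<open>z\<close>, which is at least 1.\<close>
    have "real (V + 1) / (10 * w * z) \<le> ((N + 2) * z) / (10 * w * z)"
      using V w z by (intro divide_right_mono) (auto simp: algebra_simps)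
    also have "\<dots> = (N + 2) / (10 * w)" using z by simp
    also have "\<dots> \<le> 5 * real N / (10 * w)" using N(1) w by (intro divide_right_mono) auto
    also have "\<dots> = real N / 2 / w" by simp
    also have "\<dots> = (N + 1) * (N / 2) / ((N + 1) * w)"
      by (rule mult_divide_mult_cancel_left[symmetric]) simp
    also have "\<dots> \<le> (N + 1) * (N / 2) / real D"
      using D \<open>N \<le> D\<close> N(1) by (intro divide_left_mono) auto
    finally show ?thesis by (simp add: eqs choose)
  qed
  then show ?thesis by (simp add: z_def w_def)
qed


section \<open>Isolated edges of the random multigraph\<close>

lemma finite_copies: "finite (copies ds)"
  by (simp add: copies_def)

lemma card_copies: "card (copies ds) = sum_list ds"
  by (simp add: copies_def sum_list_sum_nth atLeast0LessThan)

lemma finite_perfect_matching: "finite S \<Longrightarrow> M \<in> perfect_matchings S \<Longrightarrow> finite M"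
  using finite_subset[of M "Pow S"] by (auto simp: perfect_matchings_def partition_on_def)

lemma multigraph_matching_graph:
  assumes "M \<in> perfect_matchings (copies ds)"
  shows "multigraph (matching_graph ds M)"
  unfolding multigraph_def
proof
  fix e assume "e \<in># edges (matching_graph ds M)"
  then obtain p where p: "p \<in> M" "e = fst ` p"
    using finite_perfect_matching[OF finite_copies assms]
    by (auto simp: edges_def matching_graph_def)
  then have "p \<subseteq> copies ds" "card p = 2"
    using assms by (auto simp: perfect_matchings_def partition_on_def)
  then obtain x y where "p = {x, y}" "x \<in> copies ds" "y \<in> copies ds" by (auto simp: card_2_iff)
  then show "e \<subseteq> verts (matching_graph ds M) \<and> (card e = 1 \<or> card e = 2)"
    by (auto simp: p(2) verts_def matching_graph_def copies_def card_insert_if)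
qed

lemma count_edges_matching_graph:
  assumes "M \<in> perfect_matchings (copies ds)"
  shows "count (edges (matching_graph ds M)) e = card {p \<in> M. fst ` p = e}"
  using finite_perfect_matching[OF finite_copies assms]
  by (auto simp: edges_def matching_graph_def count_image_mset' intro!: arg_cong[of _ _ card])

text \<open>A vertex of degree 1 has the single copy with index 0, so vertex and copy determine each
  other.\<close>

definition leaf_copies :: "nat list \<Rightarrow> (nat \<times> nat) set" where
  "leaf_copies ds = (\<lambda>v. (v, 0)) ` {v. v < length ds \<and> ds ! v = 1}"

lemma card_leaf_copies: "card (leaf_copies ds) = count (mset ds) 1"
proof -
  have "card (leaf_copies ds) = card {v. v < length ds \<and> ds ! v = 1}"
    unfolding leaf_copies_def by (rule card_image) (simp add: inj_on_def)
  also have "{v. v < length ds \<and> ds ! v = 1} = {v. v < length ds \<and> 1 = ds ! v}" by auto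
  also have "card \<dots> = count (mset ds) 1" 
    by (simp only: count_mset count_list_eq_length_filter length_filter_conv_card)
  finally show ?thesis .
qed

lemma leaf_copies_subset: "leaf_copies ds \<subseteq> copies ds"
  by (auto simp: leaf_copies_def copies_def)

text \<open>An edge at \<open>x\<close> stems from a pair containing a copy of \<open>x\<close>. The
  only such copy is \<open>(x, 0)\<close>, and disjointness of the pairs leaves \<open>p\<close>
  alone.\<close>

lemma row_sum_leaf:
  assumes M: "M \<in> perfect_matchings (copies ds)"
    and p: "p \<in> M" "p = {(x, 0), (y, 0)}" "ds ! x = 1" "y < length ds"
  shows "row_sum (matching_graph ds M) x = 1"
proof -
  have "count (edges (matching_graph ds M)) {x, z} = (if z = y then 1 else 0)" for z
  proof -
    have partner: "q = p" if q: "q \<in> M" "fst ` q = {x, z}" for q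
    proof -
      have "x \<in> fst ` q" using q(2) by simp
      then obtain j where j: "(x, j) \<in> q" by auto
      then have "(x, j) \<in> copies ds"
        using M q(1) unfolding perfect_matchings_def partition_on_def by blast
      then have "(x, 0) \<in> q" using j p(3) by (simp add: copies_def)
      then have "p \<inter> q \<noteq> {}" using p(2) by blast
      then show ?thesis
        using M p(1) q(1) unfolding perfect_matchings_def partition_on_def disjoint_def by blast
    qed
    have "{q \<in> M. fst ` q = {x, z}} = {q. q = p \<and> fst ` p = {x, z}}"
      by (intro Collect_cong) (metis partner p(1))
    moreover have "fst ` p = {x, z} \<longleftrightarrow> z = y" by (auto simp: p(2) doubleton_eq_iff)
    ultimately show ?thesis by (simp add: count_edges_matching_graph[OF M])
  qed
  then have "row_sum (matching_graph ds M) x = (\<Sum>z<length ds. if z = y then 1 else 0)"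
    unfolding row_sum_def by (simp add: matching_graph_def)
  also have "\<dots> = 1" using p(4) by simp
  finally show ?thesis .
qed

text \<open>Two matched leaf copies form an isolated edge, and the pair is recovered from that edge
  by attaching the copy index 0.\<close>

lemma card_leaf_pairs_le:
  assumes M: "M \<in> perfect_matchings (copies ds)"
  shows "card {p \<in> M. p \<subseteq> leaf_copies ds} \<le> card (isolated_edges (matching_graph ds M))"
proof (rule card_inj_on_le)
  show "inj_on ((`) fst) {p \<in> M. p \<subseteq> leaf_copies ds}"
    by (rule inj_on_inverseI[of _ "\<lambda>e. (\<lambda>v. (v, 0)) ` e"]) (force simp: leaf_copies_def image_iff)
  show "(`) fst ` {p \<in> M. p \<subseteq> leaf_copies ds} \<subseteq> isolated_edges (matching_graph ds M)"
  proof (rule image_subsetI)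
    fix p assume "p \<in> {p \<in> M. p \<subseteq> leaf_copies ds}"
    then have p: "p \<in> M" "p \<subseteq> leaf_copies ds" by auto
    then have "card p = 2" using M by (simp add: perfect_matchings_def)
    then obtain a b where ab: "p = {a, b}" "a \<noteq> b" by (meson card_2_iff)
    obtain x where x: "a = (x, 0)" "x < length ds" "ds ! x = 1"
      using p(2) ab by (auto simp: leaf_copies_def)
    obtain y where y: "b = (y, 0)" "y < length ds" "ds ! y = 1"
      using p(2) ab by (auto simp: leaf_copies_def)
    have "row_sum (matching_graph ds M) x = 1" "row_sum (matching_graph ds M) y = 1"
      using row_sum_leaf[OF M p(1), of x y] row_sum_leaf[OF M p(1), of y x] ab x y
      by (auto simp: insert_commute)
    moreover have "fst ` p \<in># edges (matching_graph ds M)"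
      using p(1) finite_perfect_matching[OF finite_copies M]
      by (simp add: edges_def matching_graph_def)
    moreover have "x \<noteq> y" "fst ` p = {x, y}" using ab x(1) y(1) by auto
    ultimately show "fst ` p \<in> isolated_edges (matching_graph ds M)"
      unfolding isolated_edges_def by (intro CollectI conjI exI[of _ x] exI[of _ y]) simp_all
  qed
  show "finite (isolated_edges (matching_graph ds M))"
    by (rule finite_subset[of _ "set_mset (edges (matching_graph ds M))"])
      (auto simp: isolated_edges_def)
qed

text \<open>The bound for single instances is averaged over all matchings, with isolated edges
  replaced by pairs of leaf copies, whose mean number is known exactly.\<close>

lemma expected_ratio_greedy_cover:
  assumes "even (sum_list ds)" "0 < sum_list ds"
  shows "measure_pmf.expectation (random_multigraph ds) (approx_ratio greedy_cover)
    \<le> 2 - (count (mset ds) 1 choose 2) / real (sum_list ds - 1) / length ds"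
proof -
  let ?PM = "perfect_matchings (copies ds)"
  let ?c = "\<lambda>M. card {p \<in> M. p \<subseteq> leaf_copies ds}"
  have PM: "finite ?PM" "?PM \<noteq> {}"
    using finite_perfect_matchings[OF finite_copies] perfect_matchings_nonempty[OF finite_copies]
      assms(1) by (simp_all add: card_copies)
  \<comment> \<open>An even positive sum exceeds 1, so the denominator
    \<open>sum_list ds - 1\<close> is nonzero.\<close>
  have gt1: "1 < sum_list ds" using assms by (cases "sum_list ds = 1") auto
  have "(\<Sum>M\<in>?PM. ?c M) * (sum_list ds - 1) = (count (mset ds) 1 choose 2) * card ?PM"
    using sum_card_matching_pairs_within[OF finite_copies leaf_copies_subset]
    by (simp add: card_copies card_leaf_copies)
  from arg_cong[OF this, of real]
  have "real (\<Sum>M\<in>?PM. ?c M) * real (sum_list ds - 1) =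
      real (count (mset ds) 1 choose 2) * real (card ?PM)"
    by (simp only: of_nat_mult)
  then have mean: "real (\<Sum>M\<in>?PM. ?c M) / card ?PM =
      (count (mset ds) 1 choose 2) / real (sum_list ds - 1)"
    using PM gt1 by (simp add: frac_eq_eq)
  have "measure_pmf.expectation (random_multigraph ds) (approx_ratio greedy_cover) =
      (\<Sum>M\<in>?PM. approx_ratio greedy_cover (matching_graph ds M)) / card ?PM"
    unfolding random_multigraph_def using PM by (simp add: integral_pmf_of_set)
  also have "\<dots> \<le> (\<Sum>M\<in>?PM. 2 - real (?c M) / length ds) / card ?PM"
  proof (intro divide_right_mono sum_mono)
    fix M assume M: "M \<in> ?PM"
    have "approx_ratio greedy_cover (matching_graph ds M)
        \<le> 2 - card (isolated_edges (matching_graph ds M)) / length ds"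
      using approx_ratio_greedy_cover[OF multigraph_matching_graph[OF M]]
      by (simp add: matching_graph_def)
    also have "\<dots> \<le> 2 - real (?c M) / length ds"
      using card_leaf_pairs_le[OF M] by (simp add: divide_right_mono)
    finally show "approx_ratio greedy_cover (matching_graph ds M) \<le> 2 - real (?c M) / length ds" .
  qed simp
  also have "\<dots> = 2 - real (\<Sum>M\<in>?PM. ?c M) / card ?PM / length ds"
    using PM by (simp add: sum_subtractf sum_divide_distrib diff_divide_distrib mult.commute)
  finally show ?thesis unfolding mean .
qed

text \<open>Regroups a sum over vertices by degree; the identity for \<open>f\<close> gives the
  degree sum, the constant 1 the number of vertices.\<close>

lemma power_law_degrees_sum:
  assumes "power_law_degrees \<alpha> \<beta> ds" "0 < \<alpha>" "0 < \<beta>"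
  shows "(\<Sum>d\<leftarrow>ds. f d) = (\<Sum>i = 1..max_degree \<alpha> \<beta>. deg_count \<alpha> \<beta> i * f i :: nat)"
proof -
  have "set ds \<subseteq> {1..max_degree \<alpha> \<beta>}"
  proof
    fix i assume "i \<in> set ds"
    then have "deg_count \<alpha> \<beta> i \<noteq> 0"
      using assms(1) count_mset_gt_0[of i ds] by (simp add: power_law_degrees_def)
    then show "i \<in> {1..max_degree \<alpha> \<beta>}"
      using max_degree_ge_1[OF assms(2,3)]
      by (auto simp: deg_count_def base_count_def split: if_splits)
  qed
  then have "(\<Sum>d\<leftarrow>ds. f d) = (\<Sum>i = 1..max_degree \<alpha> \<beta>. count_list ds i * f i)"
    by (intro sum_list_map_eq_sum_count2) auto
  then show ?thesis using assms(1) by (simp add: power_law_degrees_def flip: count_mset)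
qed

theorem theorem1:
  fixes \<beta> :: real
  assumes "\<beta> > 2"
  shows "\<exists>f :: mgraph \<Rightarrow> nat set.
    poly_time_computable f \<and>
    (\<forall>G. multigraph G \<longrightarrow> vertex_cover G (f G)) \<and>
    (\<forall>(\<alpha> :: real) (ds :: nat list). \<alpha> > 0 \<longrightarrow> power_law_degrees \<alpha> \<beta> ds \<longrightarrow>
       measure_pmf.expectation (random_multigraph ds) (approx_ratio f)
         \<le> 2 - (zeta \<beta> - 1 - 1 / 2 powr \<beta>) / (2 powr \<beta> * zeta (\<beta> - 1) * zeta \<beta>))"
proof (intro exI[of _ greedy_cover] conjI allI impI)
  show "poly_time_computable greedy_cover" by (rule poly_time_greedy_cover)
  show "vertex_cover G (greedy_cover G)" if "multigraph G" for G
    using that by (rule vertex_cover_greedy)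
  fix \<alpha> :: real and ds
  assume \<alpha>: "0 < \<alpha>" and ds: "power_law_degrees \<alpha> \<beta> ds"
  have \<beta>: "0 < \<beta>" using assms by simp
  let ?k = "deg_count \<alpha> \<beta> 1" and ?D = "degree_sum \<alpha> \<beta>" and ?n = "num_vertices \<alpha> \<beta>"
  have D: "sum_list ds = ?D"
    using power_law_degrees_sum[OF ds \<alpha> \<beta>, of "\<lambda>i. i"] by (simp add: degree_sum_def mult.commute)
  have n: "length ds = ?n"
    using power_law_degrees_sum[OF ds \<alpha> \<beta>, of "\<lambda>_. 1"]
    by (simp add: num_vertices_def sum_list_triv)
  have "1 \<le> nat \<lfloor>exp \<alpha>\<rfloor>" using \<alpha> by (simp add: le_nat_iff le_floor_iff)
  then have "0 < ?k" using base_count_1[OF \<alpha> \<beta>] \<alpha> by (simp add: deg_count_def)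
  then have pos: "0 < ?D" "0 < ?n"
    using split_off_degree_1[OF \<alpha> \<beta>, of "\<lambda>i. i * deg_count \<alpha> \<beta> i"]
      split_off_degree_1[OF \<alpha> \<beta>, of "deg_count \<alpha> \<beta>"]
    by (simp_all add: degree_sum_def num_vertices_def)
  have "measure_pmf.expectation (random_multigraph ds) (approx_ratio greedy_cover)
      \<le> 2 - real (?k choose 2) / real (?D - 1) / real ?n"
    using expected_ratio_greedy_cover[of ds] even_deg_sum[OF \<alpha> \<beta>] pos(1) ds
    by (simp add: D n power_law_degrees_def degree_sum_def)
  \<comment> \<open>The mean number of isolated edges is at least a multiple of the vertex count,
    which cancels here.\<close>
  also have "\<dots> \<le> 2 - 1 / (10 * zeta (\<beta> - 1) * zeta \<beta>)"
    using isolated_pairs_bound[OF \<alpha> assms] pos(2) by (simp add: le_divide_eq mult.commute flip: divide_divide_eq_left)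
  also have "\<dots> \<le> 2 - (zeta \<beta> - 1 - 1 / 2 powr \<beta>) / (2 powr \<beta> * zeta (\<beta> - 1) * zeta \<beta>)"
    using ratio_gain_le[OF assms] by simp
  finally show "measure_pmf.expectation (random_multigraph ds) (approx_ratio greedy_cover)
      \<le> 2 - (zeta \<beta> - 1 - 1 / 2 powr \<beta>) / (2 powr \<beta> * zeta (\<beta> - 1) * zeta \<beta>)" .
qed

end
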